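(* For any nontrivial graphs $G$ and $H$ (i.e. graphs with at least two vertices), $$\operatorname{edim}(G\vee H)=\begin{cases}|V(G)|+|V(H)|-1, & \text{if } G\in\mathcal G \text{ or } H\in\mathcal G,\\ |V(G)|+|V(H)|-2, & \text{if } G,H\notin\mathcal G.\end{cases}$$
   Context: Graphs are finite, simple and undirected; $G$ and $H$ need not be connected. Edge metric dimension: for a connected graph $\Gamma=(V,E)$, $v\in V$ and $e=uw\in E$, put $d_\Gamma(e,v)=\min\{d_\Gamma(u,v),d_\Gamma(w,v)\}$. A vertex $w$ distinguishes edges $e_1,e_2$ if $d_\Gamma(w,e_1)\neq d_\Gamma(w,e_2)$. A nonempty set $S\subseteq V$ is an edge metric generator for $\Gamma$ if any two distinct edges of $\Gamma$ are distinguished by some vertex of $S$. The minimum cardinality of an edge metric generator is the edge metric dimension $\operatorname{edim}(\Gamma)$. Join: $G\vee H$ is obtained from the disjoint union of $G$ and $H$ by adding an edge between every vertex of $G$ and every vertex of $H$ (it is always connected). Class $\mathcal G$: a set $D$ of vertices of a graph $\Gamma$ is a total dominating set if every vertex of $\Gamma$ is adjacent to a vertex of $D$; the minimum cardinality of such a set is the total domination number $\gamma_t(\Gamma)$, and a total dominating set of cardinality $\gamma_t(\Gamma)$ is called a $\gamma_t(\Gamma)$-set. A graph $\Gamma$ belongs to $\mathcal G$ if for every vertex $u\in V(\Gamma)$ there is an edge $uv$ incident with $u$ such that $\{u,v\}$ is a $\gamma_t(\Gamma)$-set. If $\Gamma$ has an isolated vertex (so $\gamma_t(\Gamma)$ does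 not exist), then $\Gamma\notin\mathcal G$. *)

theory Defs
  imports "Graph_Theory.Graph_Theory"
begin

text \<open>
  A finite simple undirected graph is a \<^locale>\<open>pair_graph\<close>: a finite, loop-free, symmetric
  relation on a finite vertex set. Each undirected edge thus occurs as two arcs, so
  it is represented below by its set of end points.
\<close>

definition edges :: "'a pair_pre_digraph \<Rightarrow> 'a set set" where
  "edges G = {{u, w} | u w. (u, w) \<in> parcs G}"

definition dist_v :: "'a pair_pre_digraph \<Rightarrow> 'a \<Rightarrow> 'a \<Rightarrow> ereal" where
  "dist_v G u v = wf_digraph.\<mu> (with_proj G) (\<lambda>_. 1) u v"

definition dist_e :: "'a pair_pre_digraph \<Rightarrow> 'a set \<Rightarrow> 'a \<Rightarrow> ereal" where
  "dist_e G e v = Min ((\<lambda>u. dist_v G u v) ` e)"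

definition distinguishes :: "'a pair_pre_digraph \<Rightarrow> 'a \<Rightarrow> 'a set \<Rightarrow> 'a set \<Rightarrow> bool" where
  "distinguishes G w e1 e2 \<longleftrightarrow> dist_e G e1 w \<noteq> dist_e G e2 w"

definition edge_metric_generator :: "'a pair_pre_digraph \<Rightarrow> 'a set \<Rightarrow> bool" where
  "edge_metric_generator G S \<longleftrightarrow> S \<noteq> {} \<and> S \<subseteq> pverts G \<and>
    (\<forall>e1 \<in> edges G. \<forall>e2 \<in> edges G. e1 \<noteq> e2 \<longrightarrow> (\<exists>w \<in> S. distinguishes G w e1 e2))"

definition edim :: "'a pair_pre_digraph \<Rightarrow> nat" where
  "edim G = (LEAST n. \<exists>S. edge_metric_generator G S \<and> card S = n)"

definition graph_join ::
  "'a pair_pre_digraph \<Rightarrow> 'b pair_pre_digraph \<Rightarrow> ('a + 'b) pair_pre_digraph" where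
  "graph_join G H =
    \<lparr> pverts = pverts G <+> pverts H,
      parcs = {(Inl u, Inl v) | u v. (u, v) \<in> parcs G}
            \<union> {(Inr u, Inr v) | u v. (u, v) \<in> parcs H}
            \<union> {(Inl u, Inr v) | u v. u \<in> pverts G \<and> v \<in> pverts H}
            \<union> {(Inr v, Inl u) | u v. u \<in> pverts G \<and> v \<in> pverts H} \<rparr>"

definition total_dominating :: "'a pair_pre_digraph \<Rightarrow> 'a set \<Rightarrow> bool" where
  "total_dominating G D \<longleftrightarrow> D \<subseteq> pverts G \<and> (\<forall>u \<in> pverts G. \<exists>v \<in> D. (u, v) \<in> parcs G)"

text \<open>If \<open>G\<close> has an isolated vertex, no total dominating set exists: \<open>gamma_t G\<close> is then
  unspecified, but \<open>gamma_t_set G D\<close> is false for every \<open>D\<close>.\<close>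

definition gamma_t :: "'a pair_pre_digraph \<Rightarrow> nat" where
  "gamma_t G = (LEAST n. \<exists>D. total_dominating G D \<and> card D = n)"

definition gamma_t_set :: "'a pair_pre_digraph \<Rightarrow> 'a set \<Rightarrow> bool" where
  "gamma_t_set G D \<longleftrightarrow> total_dominating G D \<and> card D = gamma_t G"

definition class_G :: "'a pair_pre_digraph set" where
  "class_G = {G. pair_graph G \<and>
    (\<forall>u \<in> pverts G. \<exists>v. (u, v) \<in> parcs G \<and> gamma_t_set G {u, v})}"

lemma pair_graph_graph_join:
  assumes "pair_graph G" "pair_graph H"
  shows "pair_graph (graph_join G H)"
proof -
  interpret G: pair_graph G by fact
  interpret H: pair_graph H by fact
  let ?J = "graph_join G H"
  have fin: "finite (pverts ?J)"
    using G.pair_finite_verts H.pair_finite_verts by (simp add: graph_join_def)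
  have sub: "parcs ?J \<subseteq> pverts ?J \<times> pverts ?J"
    by (auto simp: graph_join_def dest: G.in_arcsD1 G.in_arcsD2 H.in_arcsD1 H.in_arcsD2)
  have "finite (parcs ?J)"
    using finite_subset[OF sub] fin by blast
  moreover have "symmetric (with_proj ?J)"
    unfolding symmetric_def sym_def
    by (auto simp: graph_join_def G.arcs_symmetric H.arcs_symmetric)
  moreover have "fst e \<noteq> snd e" if "e \<in> parcs ?J" for e
    using that by (auto simp: graph_join_def dest: G.no_loops' H.no_loops')
  ultimately show ?thesis
    using fin sub by unfold_locales auto
qed

lemma connected_graph_join:
  assumes "pair_graph G" "pair_graph H" "pverts G \<noteq> {}" "pverts H \<noteq> {}"
  shows "connected (with_proj (graph_join G H))"
proof -
  let ?J = "graph_join G H"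
  interpret J: pair_graph ?J using assms(1,2) by (rule pair_graph_graph_join)
  obtain g h where g: "g \<in> pverts G" and h: "h \<in> pverts H" using assms(3,4) by blast
  have LR: "Inl u \<rightarrow>\<^sup>*\<^bsub>with_proj ?J\<^esub> Inr v" "Inr v \<rightarrow>\<^sup>*\<^bsub>with_proj ?J\<^esub> Inl u"
    if "u \<in> pverts G" "v \<in> pverts H" for u v
    by (rule J.reachable_adjI, use that in \<open>simp add: graph_join_def\<close>)+
  have toh: "x \<rightarrow>\<^sup>*\<^bsub>with_proj ?J\<^esub> Inr h \<and> Inr h \<rightarrow>\<^sup>*\<^bsub>with_proj ?J\<^esub> x" if "x \<in> pverts ?J" for x
  proof (cases x)
    case (Inl u)
    then have "u \<in> pverts G" using that by (auto simp: graph_join_def)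
    then show ?thesis using Inl LR h by blast
  next
    case (Inr v)
    then have "v \<in> pverts H" using that by (auto simp: graph_join_def)
    then show ?thesis using Inr LR g h by (meson J.reachable_trans)
  qed
  then have "x \<rightarrow>\<^sup>*\<^bsub>with_proj ?J\<^esub> y" if "x \<in> pverts ?J" "y \<in> pverts ?J" for x y
    using that by (meson J.reachable_trans)
  then have "x \<rightarrow>\<^sup>*\<^bsub>with_proj (mk_symmetric (with_proj ?J))\<^esub> y"
    if "x \<in> pverts ?J" "y \<in> pverts ?J" for x y
    using that by (blast intro: J.reachable_mk_symmetricI)
  moreover have "pverts ?J \<noteq> {}" using g by (auto simp: graph_join_def)
  ultimately show ?thesis by (auto simp: connected_def strongly_connected_def)
qed

end

theory Submission
  imports Defs
begin

text \<open>
  Let \<open>S\<close> be a set of vertices of the join \<open>J\<close> of \<open>G\<close> and \<open>H\<close>. Distances in \<open>J\<close> are at most two,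
  so the distance from a vertex \<open>w\<close> to an edge \<open>e\<close> is 0, 1 or 2, according to whether \<open>w\<close> lies
  in \<open>e\<close>, has a neighbour in \<open>e\<close>, or neither. In particular every vertex that lies in exactly one
  of two edges distinguishes them. Two distinct edges \<open>e1\<close>, \<open>e2\<close> both have an end point outside
  the other one, so if \<open>S\<close> fails to distinguish them, it misses both of these end points.

  Hence all vertices but one always form a generator. If \<open>S\<close> consists of all vertices but
  \<open>x\<close> and \<open>y\<close>, the only critical pairs are \<open>{x, c}\<close>, \<open>{y, c}\<close> for a common neighbour \<open>c\<close> of \<open>x\<close>
  and \<open>y\<close>; such a pair is distinguished by some \<open>w\<close> outside of both edges exactly when \<open>w\<close> is
  adjacent to one of \<open>x\<close>, \<open>y\<close>, but neither to the other one nor to \<open>c\<close>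
  (\<open>generator_minus_pair_iff\<close>). In a join this means the following.

  \<^item> If \<open>x\<close> and \<open>y\<close> both belong to \<open>G\<close>, then any vertex \<open>c\<close> of \<open>H\<close> yields a pair that is not
    distinguished: the vertices not adjacent to \<open>c\<close> lie in \<open>H\<close> and are adjacent to both \<open>x\<close> and
    \<open>y\<close>. So a generator misses at most one vertex of \<open>G\<close>, and likewise at most one of \<open>H\<close>.

  \<^item> If \<open>x\<close> belongs to \<open>G\<close>, \<open>y\<close> to \<open>H\<close> and \<open>c\<close> to \<open>G\<close>, then the required \<open>w\<close> is a vertex of \<open>G\<close>
    adjacent to neither \<open>x\<close> nor \<open>c\<close>. It exists for all neighbours \<open>c\<close> of \<open>x\<close> in \<open>G\<close> if and only
    if no edge of \<open>G\<close> at \<open>x\<close> is totally dominating; and symmetrically for \<open>c\<close> in \<open>H\<close>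
    (\<open>generator_minus_cross_pair_iff\<close>).

  A total dominating set has at least two elements, so the class \<open>\<G>\<close> consists of the graphs in
  which every vertex lies on a totally dominating edge (\<open>class_G_iff\<close>). Therefore a generator can
  miss two vertices of \<open>J\<close> exactly when neither \<open>G\<close> nor \<open>H\<close> belongs to \<open>\<G>\<close>, and it can never
  miss three.
\<close>

section \<open>Distances in graphs of diameter at most two\<close>

context pair_wf_digraph
begin

lemma awalk_cost_one: "awalk_cost (\<lambda>_. 1) p = real (length p)"
  by (induct p) auto

lemma dist_v_le_walk_length: "awalk u p v \<Longrightarrow> dist_v G u v \<le> ereal (length p)"
  using min_cost_le_walk_cost[of u p v "\<lambda>_. 1"] by (simp add: dist_v_def awalk_cost_one)

lemma dist_v_ge:
  assumes "\<And>p. awalk u p v \<Longrightarrow> n \<le> length p"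
  shows "ereal n \<le> dist_v G u v"
  unfolding dist_v_def \<mu>_def
  by (rule INF_greatest) (use assms in \<open>auto simp: awalk_cost_one\<close>)

end

locale diam_le_two_graph = pair_graph +
  assumes common_neighbour:
    "\<lbrakk>u \<in> pverts G; v \<in> pverts G; u \<noteq> v; (u, v) \<notin> parcs G\<rbrakk>
      \<Longrightarrow> \<exists>c. (u, c) \<in> parcs G \<and> (c, v) \<in> parcs G"
begin

lemma dist_v_eq:
  assumes u: "u \<in> pverts G" and v: "v \<in> pverts G"
  shows "dist_v G u v = (if u = v then 0 else if (u, v) \<in> parcs G then 1 else 2)"
proof -
  consider (eq) "u = v" | (adj) "u \<noteq> v" "(u, v) \<in> parcs G"
    | (far) "u \<noteq> v" "(u, v) \<notin> parcs G" by blast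
  then show ?thesis
  proof cases
    case eq
    have "dist_v G u v \<le> 0"
      using dist_v_le_walk_length[of u "[]" v] eq u by (simp add: awalk_Nil_iff zero_ereal_def)
    moreover have "0 \<le> dist_v G u v"
      using dist_v_ge[of u v 0] by (simp add: zero_ereal_def)
    ultimately show ?thesis using eq by simp
  next
    case adj
    have "dist_v G u v \<le> 1"
      using dist_v_le_walk_length[of u "[(u, v)]" v] adj u v
      by (simp add: awalk_simps one_ereal_def)
    moreover have "1 \<le> length p" if "awalk u p v" for p
      using that adj by (cases p) (auto simp: awalk_simps)
    then have "1 \<le> dist_v G u v"
      using dist_v_ge[of u v 1] by (simp add: one_ereal_def)
    ultimately show ?thesis using adj by simp
  next
    case far
    obtain c where c: "(u, c) \<in> parcs G" "(c, v) \<in> parcs G"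
      using common_neighbour u v far by blast
    have "dist_v G u v \<le> 2"
      using dist_v_le_walk_length[of u "[(u, c), (c, v)]" v] c u v in_arcsD2[OF c(1)]
      by (simp add: awalk_simps)
    moreover have "2 \<le> length p" if "awalk u p v" for p
    proof (cases p)
      case Nil
      then show ?thesis using that far by (simp add: awalk_simps)
    next
      case (Cons e q)
      then show ?thesis using that far by (cases q) (auto simp: awalk_simps)
    qed
    then have "2 \<le> dist_v G u v"
      using dist_v_ge[of u v 2] by simp
    ultimately show ?thesis using far by simp
  qed
qed

lemma dist_e_eq:
  assumes e: "e \<in> edges G" and w: "w \<in> pverts G"
  shows "dist_e G e w =
    (if w \<in> e then 0 else if \<exists>u\<in>e. (u, w) \<in> parcs G then 1 else 2)"
proof -
  obtain u v where uv: "(u, v) \<in> parcs G" "e = {u, v}" using e by (auto simp: edges_def)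
  then have "u \<in> pverts G" "v \<in> pverts G" by (auto dest: in_arcsD1 in_arcsD2)
  then show ?thesis
    using uv w by (auto simp: dist_e_def dist_v_eq min_def)
qed

end

section \<open>Edge metric generators missing one or two vertices\<close>

lemma edge_metric_generator_mono:
  assumes "edge_metric_generator G S" "S \<subseteq> T" "T \<subseteq> pverts G"
  shows "edge_metric_generator G T"
  using assms unfolding edge_metric_generator_def by blast

context diam_le_two_graph
begin

lemma edge_endpoints:
  assumes "e \<in> edges G"
  shows "e \<subseteq> pverts G" and "card e = 2"
  using assms by (auto simp: edges_def dest: in_arcsD1 in_arcsD2 no_loops')

lemma distinguishes_in_one:
  assumes "e1 \<in> edges G" "e2 \<in> edges G" "w \<in> pverts G" "w \<in> e1 \<longleftrightarrow> w \<notin> e2"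
  shows "distinguishes G w e1 e2"
  using assms by (auto simp: distinguishes_def dist_e_eq)

lemma edges_difference_nonempty:
  assumes "e1 \<in> edges G" "e2 \<in> edges G" "e1 \<noteq> e2"
  shows "e1 - e2 \<noteq> {}"
  using assms edge_endpoints(2)
  by (metis Diff_eq_empty_iff card.infinite card_subset_eq zero_neq_numeral)

text \<open>
  This confines the search for undistinguished edges: a generator that misses only \<open>x\<close> and \<open>y\<close>
  can fail only at two edges that share an end point and differ in having \<open>x\<close> or \<open>y\<close> as the other.
  For \<open>x = y\<close> the conclusion \<open>x \<noteq> y\<close> is a
  contradiction, so a single missing vertex does no harm.
\<close>

lemma undistinguished_edges:
  assumes e: "e1 \<in> edges G" "e2 \<in> edges G" "e1 \<noteq> e2"
    and nd: "\<And>w. w \<in> pverts G - {x, y} \<Longrightarrow> \<not> distinguishes G w e1 e2"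
  obtains c where "e1 = {x, c} \<and> e2 = {y, c} \<or> e1 = {y, c} \<and> e2 = {x, c}"
    and "(x, c) \<in> parcs G" "(y, c) \<in> parcs G" and "x \<noteq> y"
proof -
  have sub: "e1 - e2 \<subseteq> {x, y}" "e2 - e1 \<subseteq> {x, y}"
    using e nd edge_endpoints(1) distinguishes_in_one by blast+
  obtain p q where p: "p \<in> e1" "p \<notin> e2" and q: "q \<in> e2" "q \<notin> e1"
    using edges_difference_nonempty e by blast
  obtain c where c: "e1 = {p, c}" "(p, c) \<in> parcs G"
    using e(1) p(1) arcs_symmetric by (auto simp: edges_def)
  obtain d where d: "e2 = {q, d}" "(q, d) \<in> parcs G"
    using e(2) q(1) arcs_symmetric by (auto simp: edges_def)
  have "p \<noteq> c" "q \<noteq> d" using c d no_loops' by blast+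
  moreover have "p \<in> {x, y}" "q \<in> {x, y}" "p \<noteq> q" using sub p q by blast+
  \<comment> \<open>A vertex in just one of the two edges is \<open>x\<close> or \<open>y\<close>, and these are \<open>p\<close> and \<open>q\<close>;
    so the remaining end points \<open>c\<close> and \<open>d\<close> lie in both edges.\<close>
  ultimately have "c = d" using sub c d p q by auto
  with c d \<open>p \<in> {x, y}\<close> \<open>q \<in> {x, y}\<close> \<open>p \<noteq> q\<close> show ?thesis by (intro that[of c]) auto
qed

lemma generator_minus_vertex:
  assumes "pverts G - {v} \<noteq> {}"
  shows "edge_metric_generator G (pverts G - {v})"
  unfolding edge_metric_generator_def
proof (intro conjI ballI impI assms Diff_subset)
  fix e1 e2 assume e: "e1 \<in> edges G" "e2 \<in> edges G" "e1 \<noteq> e2"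
  show "\<exists>w\<in>pverts G - {v}. distinguishes G w e1 e2"
    using undistinguished_edges[OF e, of v v] by blast
qed

text \<open>
  For \<open>w\<close> other than \<open>x\<close>, \<open>y\<close>, \<open>c\<close>, the distances to \<open>{x, c}\<close> and \<open>{y, c}\<close> are 1 or 2. A neighbour
  \<open>w\<close> of \<open>c\<close> is at distance 1 from both, and any other \<open>w\<close> is at distance 1 from the edge whose
  private end point is adjacent to \<open>w\<close>.
\<close>

lemma generator_minus_pair_iff:
  assumes xy: "x \<noteq> y" and ne: "pverts G - {x, y} \<noteq> {}"
  shows "edge_metric_generator G (pverts G - {x, y}) \<longleftrightarrow>
    (\<forall>c. (x, c) \<in> parcs G \<longrightarrow> (y, c) \<in> parcs G \<longrightarrow>
      (\<exists>w\<in>pverts G - {x, y, c}. (c, w) \<notin> parcs G \<and>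
        ((x, w) \<in> parcs G \<longleftrightarrow> (y, w) \<notin> parcs G)))"
    (is "?gen \<longleftrightarrow> (\<forall>c. _ \<longrightarrow> _ \<longrightarrow> ?sep c)")
proof -
  have sep: "(\<exists>w\<in>pverts G - {x, y}. distinguishes G w {x, c} {y, c}) \<longleftrightarrow> ?sep c"
    if c: "(x, c) \<in> parcs G" "(y, c) \<in> parcs G" for c
  proof -
    have "{x, c} \<in> edges G" "{y, c} \<in> edges G" using c by (auto simp: edges_def)
    then have "distinguishes G w {x, c} {y, c} \<longleftrightarrow>
        w \<noteq> c \<and> (c, w) \<notin> parcs G \<and> ((x, w) \<in> parcs G \<longleftrightarrow> (y, w) \<notin> parcs G)"
      if "w \<in> pverts G - {x, y}" for w
      using that by (auto simp: distinguishes_def dist_e_eq)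
    then show ?thesis by blast
  qed
  show ?thesis
  proof
    assume gen: ?gen
    show "\<forall>c. (x, c) \<in> parcs G \<longrightarrow> (y, c) \<in> parcs G \<longrightarrow> ?sep c"
    proof (intro allI impI)
      fix c assume c: "(x, c) \<in> parcs G" "(y, c) \<in> parcs G"
      then have "{x, c} \<in> edges G" "{y, c} \<in> edges G" by (auto simp: edges_def)
      moreover have "{x, c} \<noteq> {y, c}" using xy c no_loops' by (auto simp: doubleton_eq_iff)
      ultimately have "\<exists>w\<in>pverts G - {x, y}. distinguishes G w {x, c} {y, c}"
        using gen unfolding edge_metric_generator_def by metis
      then show "?sep c" using sep[OF c] by simp
    qed
  next
    assume all: "\<forall>c. (x, c) \<in> parcs G \<longrightarrow> (y, c) \<in> parcs G \<longrightarrow> ?sep c"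
    show ?gen
      unfolding edge_metric_generator_def
    proof (intro conjI ballI impI ne Diff_subset, rule ccontr)
      fix e1 e2 assume e: "e1 \<in> edges G" "e2 \<in> edges G" "e1 \<noteq> e2"
        and "\<not> (\<exists>w\<in>pverts G - {x, y}. distinguishes G w e1 e2)"
      then have nd: "\<not> distinguishes G w e1 e2" if "w \<in> pverts G - {x, y}" for w
        using that by blast
      obtain c where "e1 = {x, c} \<and> e2 = {y, c} \<or> e1 = {y, c} \<and> e2 = {x, c}"
        and c: "(x, c) \<in> parcs G" "(y, c) \<in> parcs G"
        using undistinguished_edges[OF e nd] by blast
      then have "\<not> distinguishes G w {x, c} {y, c}" if "w \<in> pverts G - {x, y}" for w
        using nd[OF that] by (auto simp: distinguishes_def)
      then show False using sep[OF c] all[rule_format, OF c] by simp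
    qed
  qed
qed

end

section \<open>The class of graphs totally dominated by an edge at every vertex\<close>

lemma (in pair_graph) two_le_card_total_dominating:
  assumes "total_dominating G D" "pverts G \<noteq> {}"
  shows "2 \<le> card D"
proof -
  have D: "D \<subseteq> pverts G" "\<forall>u\<in>pverts G. \<exists>v\<in>D. (u, v) \<in> parcs G"
    using assms(1) by (auto simp: total_dominating_def)
  obtain v where v: "v \<in> D" using D(2) assms(2) by blast
  then obtain v' where v': "v' \<in> D" "(v, v') \<in> parcs G" using D by blast
  have "card {v, v'} \<le> card D"
    using v v' D(1) pair_finite_verts finite_subset by (intro card_mono) blast+
  moreover have "v \<noteq> v'" using v' no_loops' by blast
  ultimately show ?thesis by simp
qed

text \<open>
  The minimality of a \<open>\<gamma>\<^sub>t\<close>-set comes for free on an edge, whose two end points already attain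
  the lower bound above.
\<close>

lemma (in pair_graph) gamma_t_set_edge_iff:
  assumes "(u, v) \<in> parcs G"
  shows "gamma_t_set G {u, v} \<longleftrightarrow> total_dominating G {u, v}"
proof
  assume dom: "total_dominating G {u, v}"
  have "u \<noteq> v" using assms no_loops' by blast
  then have "card {u, v} = 2" by simp
  moreover have "2 \<le> card D" if "total_dominating G D" for D
    using two_le_card_total_dominating that assms in_arcsD1 by blast
  ultimately have "gamma_t G = 2"
    unfolding gamma_t_def using dom by (intro Least_equality) blast+
  with dom \<open>card {u, v} = 2\<close> show "gamma_t_set G {u, v}" by (simp add: gamma_t_set_def)
qed (simp add: gamma_t_set_def)

definition in_dominating_edge :: "'a pair_pre_digraph \<Rightarrow> 'a \<Rightarrow> bool" where
  "in_dominating_edge G u \<longleftrightarrow> (\<exists>v. (u, v) \<in> parcs G \<and> total_dominating G {u, v})"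

lemma class_G_iff:
  assumes "pair_graph G"
  shows "G \<in> class_G \<longleftrightarrow> (\<forall>u\<in>pverts G. in_dominating_edge G u)"
  using assms pair_graph.gamma_t_set_edge_iff[OF assms]
  unfolding class_G_def in_dominating_edge_def by blast

text \<open>
  The witness \<open>w\<close> can be taken outside of \<open>{u, c}\<close> because the end points of an edge dominate
  each other. This is the form in which the condition appears in \<open>generator_minus_pair_iff\<close>.
\<close>

lemma (in pair_graph) not_in_dominating_edge_iff:
  assumes "u \<in> pverts G"
  shows "\<not> in_dominating_edge G u \<longleftrightarrow>
    (\<forall>c. (u, c) \<in> parcs G \<longrightarrow>
      (\<exists>w\<in>pverts G - {u, c}. (c, w) \<notin> parcs G \<and> (u, w) \<notin> parcs G))"
proof -
  have "\<not> total_dominating G {u, c} \<longleftrightarrow>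
      (\<exists>w\<in>pverts G - {u, c}. (c, w) \<notin> parcs G \<and> (u, w) \<notin> parcs G)"
    if "(u, c) \<in> parcs G" for c
    using that assms in_arcsD2[OF that] arcs_symmetric unfolding total_dominating_def by blast
  then show ?thesis unfolding in_dominating_edge_def by blast
qed

section \<open>Generators of a join\<close>

locale nonempty_join = G: pair_graph G + H: pair_graph H
  for G :: "'a pair_pre_digraph" and H :: "'b pair_pre_digraph" +
  assumes verts_G: "pverts G \<noteq> {}" and verts_H: "pverts H \<noteq> {}"
begin

abbreviation "J \<equiv> graph_join G H"

lemma join_verts: "Inl u \<in> pverts J \<longleftrightarrow> u \<in> pverts G" "Inr v \<in> pverts J \<longleftrightarrow> v \<in> pverts H"
  by (auto simp: graph_join_def)

lemma join_arcs:
  "(Inl u, Inl u') \<in> parcs J \<longleftrightarrow> (u, u') \<in> parcs G"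
  "(Inr v, Inr v') \<in> parcs J \<longleftrightarrow> (v, v') \<in> parcs H"
  "(Inl u, Inr v) \<in> parcs J \<longleftrightarrow> u \<in> pverts G \<and> v \<in> pverts H"
  "(Inr v, Inl u) \<in> parcs J \<longleftrightarrow> u \<in> pverts G \<and> v \<in> pverts H"
  by (auto simp: graph_join_def)

lemma Bex_join_verts:
  "(\<exists>w\<in>pverts J - A. P w) \<longleftrightarrow>
    (\<exists>u\<in>pverts G. Inl u \<notin> A \<and> P (Inl u)) \<or> (\<exists>v\<in>pverts H. Inr v \<notin> A \<and> P (Inr v))"
  by (auto simp: graph_join_def)

sublocale J: diam_le_two_graph J
proof -
  interpret pair_graph J by (rule pair_graph_graph_join) unfold_locales
  show "diam_le_two_graph J"
  proof
    fix x y assume "x \<in> pverts J" "y \<in> pverts J" "x \<noteq> y" "(x, y) \<notin> parcs J"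
    then show "\<exists>c. (x, c) \<in> parcs J \<and> (c, y) \<in> parcs J"
      using verts_G verts_H
      by (cases x; cases y) (auto simp: split_sum_ex join_verts join_arcs)
  qed
qed

text \<open>
  For any vertex \<open>h\<close> of \<open>H\<close>, the edges from \<open>a\<close> and from \<open>b\<close> to \<open>h\<close> can be told apart only by
  \<open>a\<close> and \<open>b\<close> themselves: every other vertex of \<open>G\<close> is adjacent to \<open>h\<close>, and every other vertex of
  \<open>H\<close> is adjacent to both \<open>a\<close> and \<open>b\<close>.
\<close>

lemma generator_misses_at_most_one_of_G:
  assumes "edge_metric_generator J S" "Inl a \<in> pverts J - S" "Inl b \<in> pverts J - S"
  shows "a = b"
proof (rule ccontr)
  assume "a \<noteq> b"
  obtain h where h: "h \<in> pverts H" using verts_H by blast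
  have "edge_metric_generator J (pverts J - {Inl a, Inl b})"
    using assms by (intro edge_metric_generator_mono[OF assms(1)])
      (auto simp: edge_metric_generator_def)
  moreover have "pverts J - {Inl a, Inl b} \<noteq> {}" using h join_verts(2) by blast
  ultimately show False
    using \<open>a \<noteq> b\<close> h assms(2,3)
    by (auto simp: J.generator_minus_pair_iff Bex_join_verts split_sum_all join_verts join_arcs)
qed

lemma generator_misses_at_most_one_of_H:
  assumes "edge_metric_generator J S" "Inr a \<in> pverts J - S" "Inr b \<in> pverts J - S"
  shows "a = b"
proof (rule ccontr)
  assume "a \<noteq> b"
  obtain g where g: "g \<in> pverts G" using verts_G by blast
  have "edge_metric_generator J (pverts J - {Inr a, Inr b})"
    using assms by (intro edge_metric_generator_mono[OF assms(1)])
      (auto simp: edge_metric_generator_def)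
  moreover have "pverts J - {Inr a, Inr b} \<noteq> {}" using g join_verts(1) by blast
  ultimately show False
    using \<open>a \<noteq> b\<close> g assms(2,3)
    by (auto simp: J.generator_minus_pair_iff Bex_join_verts split_sum_all join_verts join_arcs)
qed

text \<open>
  A common neighbour of \<open>a\<close> and \<open>b\<close> is a neighbour of \<open>a\<close> in \<open>G\<close> or of \<open>b\<close> in \<open>H\<close>. In the first
  case the vertices not adjacent to it lie in \<open>G\<close> and are adjacent to \<open>b\<close>, so that one of them
  separates the two edges if and only if it is not adjacent to \<open>a\<close>.
\<close>

lemma generator_minus_cross_pair_iff:
  assumes a: "a \<in> pverts G" and b: "b \<in> pverts H"
    and ne: "pverts J - {Inl a, Inr b} \<noteq> {}"
  shows "edge_metric_generator J (pverts J - {Inl a, Inr b}) \<longleftrightarrow>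
    \<not> in_dominating_edge G a \<and> \<not> in_dominating_edge H b"
proof -
  have "edge_metric_generator J (pverts J - {Inl a, Inr b}) \<longleftrightarrow>
    (\<forall>c. (a, c) \<in> parcs G \<longrightarrow>
      (\<exists>w\<in>pverts G - {a, c}. (c, w) \<notin> parcs G \<and> (a, w) \<notin> parcs G)) \<and>
    (\<forall>c. (b, c) \<in> parcs H \<longrightarrow>
      (\<exists>w\<in>pverts H - {b, c}. (c, w) \<notin> parcs H \<and> (b, w) \<notin> parcs H))"
    using a b ne G.in_arcsD2 H.in_arcsD2
    by (simp add: J.generator_minus_pair_iff Bex_join_verts split_sum_all join_verts join_arcs)
      blast
  then show ?thesis
    using G.not_in_dominating_edge_iff[OF a] H.not_in_dominating_edge_iff[OF b] by simp
qed

lemma card_join: "card (pverts J) = card (pverts G) + card (pverts H)"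
  by (simp add: graph_join_def card_Plus G.pair_finite_verts H.pair_finite_verts)

lemma card_missed_le_two:
  assumes "edge_metric_generator J S"
  shows "card (pverts J - S) \<le> 2"
proof -
  define A where "A = {u. Inl u \<in> pverts J - S}"
  define B where "B = {v. Inr v \<in> pverts J - S}"
  have fin: "finite A" "finite B"
    using finite_subset[OF _ G.pair_finite_verts, of A] finite_subset[OF _ H.pair_finite_verts, of B]
    by (auto simp: A_def B_def join_verts)
  then have "card A \<le> 1" "card B \<le> 1"
    using generator_misses_at_most_one_of_G[OF assms] generator_misses_at_most_one_of_H[OF assms]
    by (simp_all add: card_le_Suc0_iff_eq A_def B_def)
  moreover have "pverts J - S = A <+> B" by (auto simp: graph_join_def A_def B_def)
  ultimately show ?thesis by (simp add: card_Plus fin)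
qed

lemma card_missed_le_one:
  assumes gen: "edge_metric_generator J S" and cls: "G \<in> class_G \<or> H \<in> class_G"
  shows "card (pverts J - S) \<le> 1"
proof (rule ccontr)
  assume "\<not> card (pverts J - S) \<le> 1"
  then obtain x y where xy: "x \<in> pverts J - S" "y \<in> pverts J - S" "x \<noteq> y"
    using J.pair_finite_verts by (auto simp: card_le_Suc0_iff_eq)
  then obtain a b where ab: "Inl a \<in> pverts J - S" "Inr b \<in> pverts J - S"
    using generator_misses_at_most_one_of_G[OF gen] generator_misses_at_most_one_of_H[OF gen]
    by (cases x; cases y) blast+
  have S: "S \<noteq> {}" "S \<subseteq> pverts J - {Inl a, Inr b}"
    using gen ab by (auto simp: edge_metric_generator_def)
  then have "edge_metric_generator J (pverts J - {Inl a, Inr b})"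
    using edge_metric_generator_mono[OF gen] by blast
  then have "\<not> in_dominating_edge G a" "\<not> in_dominating_edge H b"
    using generator_minus_cross_pair_iff[of a b] S ab join_verts by blast+
  then show False
    using cls ab join_verts class_G_iff[OF G.pair_graph_axioms] class_G_iff[OF H.pair_graph_axioms]
    by blast
qed

lemma edim_eqI:
  assumes "edge_metric_generator J (pverts J - A)" "A \<subseteq> pverts J"
    and "\<And>S. edge_metric_generator J S \<Longrightarrow> card (pverts J - S) \<le> card A"
  shows "edim J = card (pverts J) - card A"
  unfolding edim_def
proof (rule Least_equality)
  have fin: "finite A" using assms(2) J.pair_finite_verts by (rule finite_subset)
  show "\<exists>S. edge_metric_generator J S \<and> card S = card (pverts J) - card A"
    using assms(1) card_Diff_subset[OF fin assms(2)] by blast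
  fix n assume "\<exists>S. edge_metric_generator J S \<and> card S = n"
  then obtain S where S: "edge_metric_generator J S" "card S = n" by blast
  then have sub: "S \<subseteq> pverts J" by (simp add: edge_metric_generator_def)
  then have "finite S" using J.pair_finite_verts by (rule finite_subset)
  then have "card (pverts J) - card S \<le> card A"
    using assms(3)[OF S(1)] card_Diff_subset[of S "pverts J"] sub by simp
  then show "card (pverts J) - card A \<le> n" using S(2) by linarith
qed

end

section \<open>The edge metric dimension of a join\<close>

theorem theorem1:
  fixes G :: "'a pair_pre_digraph" and H :: "'b pair_pre_digraph"
  assumes "pair_graph G" and "pair_graph H"
    and "card (pverts G) \<ge> 2" and "card (pverts H) \<ge> 2"
  shows "edim (graph_join G H) =
    (if G \<in> class_G \<or> H \<in> class_G
     then card (pverts G) + card (pverts H) - 1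
     else card (pverts G) + card (pverts H) - 2)"
proof -
  interpret G: pair_graph G by fact
  interpret H: pair_graph H by fact
  interpret nonempty_join G H
    by unfold_locales (use assms(3,4) in auto)
  have ne: "pverts J - A \<noteq> {}" if "finite A" "card A \<le> 2" for A
    using assms(3,4) that card_join card_mono[of A "pverts J"] by auto
  show ?thesis
  proof (cases "G \<in> class_G \<or> H \<in> class_G")
    case True
    obtain a where "Inl a \<in> pverts J" using verts_G join_verts(1) by blast
    moreover have "edge_metric_generator J (pverts J - {Inl a})"
      by (rule J.generator_minus_vertex, rule ne) auto
    ultimately have "edim J = card (pverts J) - card {Inl a :: 'a + 'b}"
      using card_missed_le_one True by (intro edim_eqI) auto
    then show ?thesis using True card_join by simp
  next
    case False
    then obtain a b where ab: "a \<in> pverts G" "\<not> in_dominating_edge G a"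
        "b \<in> pverts H" "\<not> in_dominating_edge H b"
      using class_G_iff[OF assms(1)] class_G_iff[OF assms(2)] by blast
    have "pverts J - {Inl a, Inr b} \<noteq> {}" by (rule ne) auto
    then have "edge_metric_generator J (pverts J - {Inl a, Inr b})"
      using generator_minus_cross_pair_iff ab by blast
    moreover have "card {Inl a :: 'a + 'b, Inr b} = 2" by simp
    ultimately have "edim J = card (pverts J) - card {Inl a :: 'a + 'b, Inr b}"
      using card_missed_le_two ab join_verts by (intro edim_eqI) (simp_all only: insert_subset empty_subsetI)
    then show ?thesis using False card_join by simp
  qed
qed

end
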